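(* Let $y_{\rm qc}\in\mathcal{Y}^\varepsilon$ satisfy $\min_\ell(y_{\rm qc})'_\ell\ge r_*/2$. Then $$E_{\rm a}''(y_{\rm qc})[v,v]\ge A_*(y_{\rm qc})\,\|v'\|_{\ell^2_\varepsilon}^2\qquad\forall v\in\mathcal{U}^\varepsilon,$$ where $A_*(y_{\rm qc}):=\min_{\ell=-N+1,\dots,N}A_\ell(y_{\rm qc})$ and $$A_\ell(y):=\phi''(y_\ell')+2\phi''(y_{\ell-1}'+y_\ell')+2\phi''(y_\ell'+y_{\ell+1}').$$
   Context: Fix $N\in\mathbb{N}$, $F>0$, $\varepsilon=1/(2N)$. $\phi\in C^3(0,\infty)$ and there is $r_*>0$ such that $\phi$ is convex on $(0,r_* )$ and concave on $(r_*,\infty)$. For $v\in\mathbb{R}^{\mathbb{Z}}$, $v_\ell':=(v_\ell-v_{\ell-1})/\varepsilon$ and $\|v'\|_{\ell^2_\varepsilon}^2:=\varepsilon\sum_{\ell=-N+1}^N|v_\ell'|^2$. $\mathcal{U}^\varepsilon:=\{u\in\mathbb{R}^{\mathbb{Z}}:u_{\ell+2N}=u_\ell,\ u_0=0\}$; $\mathcal{Y}^\varepsilon:=\{y\in\mathbb{R}^{\mathbb{Z}}:y_{\ell+2N}=F+y_\ell,\ y_0=0\}$. The total atomistic energy is $E_{\rm a}(y)=\mathcal{E}_{\rm a}(y)-\varepsilon\sum_{\ell=-N+1}^Nf_\ell\,(y_\ell-F\varepsilon\ell)$, where $f$ is a fixed $2N$-periodic lattice force and $\mathcal{E}_{\rm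 a}(y)=\varepsilon\sum_{\ell=-N+1}^N\phi(y_\ell')+\varepsilon\sum_{\ell=-N+1}^N\phi(y_{\ell-1}'+y_\ell')$. Its second variation is $E_{\rm a}''(y)[v,v]=\varepsilon\sum_{\ell=-N+1}^N\phi''(y_\ell')|v_\ell'|^2+\varepsilon\sum_{\ell=-N+1}^N\phi''(y_\ell'+y_{\ell+1}')|v_\ell'+v_{\ell+1}'|^2$. *)

theory Defs
  imports "HOL-Analysis.Analysis"
begin

text \<open>
  Meant for open sets: iterated two-sided derivatives, so that only the values of \<open>f\<close> near \<open>S\<close>
  matter. In particular a potential on \<open>(0, \<infinity>)\<close> is a total function whose values
  at nonpositive arguments are irrelevant.
\<close>

definition C_on :: "nat \<Rightarrow> (real \<Rightarrow> real) \<Rightarrow> real set \<Rightarrow> bool" where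
  "C_on k f S \<longleftrightarrow>
     (\<forall>j<k. \<forall>x\<in>S. (deriv ^^ j) f differentiable (at x)) \<and> continuous_on S ((deriv ^^ k) f)"

definition eps :: "nat \<Rightarrow> real" where
  "eps N = 1 / (2 * real N)"

definition period_cell :: "nat \<Rightarrow> int set" where
  "period_cell N = {- int N + 1 .. int N}"

definition periodic_lattice :: "nat \<Rightarrow> (int \<Rightarrow> real) \<Rightarrow> bool" where
  "periodic_lattice N v \<longleftrightarrow> (\<forall>l. v (l + 2 * int N) = v l)"

definition bdiff :: "nat \<Rightarrow> (int \<Rightarrow> real) \<Rightarrow> int \<Rightarrow> real" where
  "bdiff N v l = (v l - v (l - 1)) / eps N"

definition l2_norm_eps :: "nat \<Rightarrow> (int \<Rightarrow> real) \<Rightarrow> real" where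
  "l2_norm_eps N w = sqrt (eps N * (\<Sum>l\<in>period_cell N. \<bar>w l\<bar>\<^sup>2))"

definition displacements :: "nat \<Rightarrow> (int \<Rightarrow> real) set" where
  "displacements N = {u. periodic_lattice N u \<and> u 0 = 0}"

definition deformations :: "nat \<Rightarrow> real \<Rightarrow> (int \<Rightarrow> real) set" where
  "deformations N F = {y. (\<forall>l. y (l + 2 * int N) = F + y l) \<and> y 0 = 0}"

definition stored_energy :: "nat \<Rightarrow> (real \<Rightarrow> real) \<Rightarrow> (int \<Rightarrow> real) \<Rightarrow> real" where
  "stored_energy N \<phi> y =
     eps N * (\<Sum>l\<in>period_cell N. \<phi> (bdiff N y l)) +
     eps N * (\<Sum>l\<in>period_cell N. \<phi> (bdiff N y (l - 1) + bdiff N y l))"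

definition total_energy ::
    "nat \<Rightarrow> real \<Rightarrow> (real \<Rightarrow> real) \<Rightarrow> (int \<Rightarrow> real) \<Rightarrow> (int \<Rightarrow> real) \<Rightarrow> real" where
  "total_energy N F \<phi> f y =
     stored_energy N \<phi> y -
     eps N * (\<Sum>l\<in>period_cell N. f l * (y l - F * eps N * real_of_int l))"

text \<open>
  The bilinear form \<open>E''(y)[v, w]\<close>, as the mixed second directional derivative of \<open>E\<close>.
  Since \<open>deriv\<close> is total, the definition is meaningful only where these derivatives exist;
  lemma \<open>second_variation_total_energy\<close> below shows that for the atomistic energy,
  at deformations with positive strains, it gives the expected explicit formula.
\<close>

definition second_variation ::
    "((int \<Rightarrow> real) \<Rightarrow> real) \<Rightarrow> (int \<Rightarrow> real) \<Rightarrow> (int \<Rightarrow> real) \<Rightarrow> (int \<Rightarrow> real) \<Rightarrow> real" where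
  "second_variation E y v w =
     deriv (\<lambda>s. deriv (\<lambda>t. E (\<lambda>l. y l + s * v l + t * w l)) 0) 0"

definition A_coeff :: "nat \<Rightarrow> (real \<Rightarrow> real) \<Rightarrow> (int \<Rightarrow> real) \<Rightarrow> int \<Rightarrow> real" where
  "A_coeff N \<phi> y l =
     (deriv ^^ 2) \<phi> (bdiff N y l) +
     2 * (deriv ^^ 2) \<phi> (bdiff N y (l - 1) + bdiff N y l) +
     2 * (deriv ^^ 2) \<phi> (bdiff N y l + bdiff N y (l + 1))"

definition A_star :: "nat \<Rightarrow> (real \<Rightarrow> real) \<Rightarrow> (int \<Rightarrow> real) \<Rightarrow> real" where
  "A_star N \<phi> y = Min (A_coeff N \<phi> y ` period_cell N)"

text \<open>
  Consistency of \<open>second_variation\<close> with the explicit formula for the atomistic energy.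
\<close>

lemma bdiff_periodic:
  assumes "y \<in> deformations N F \<or> y \<in> displacements N"
  shows "bdiff N y (l + 2 * int N) = bdiff N y l"
proof -
  have "l + 2 * int N - 1 = (l - 1) + 2 * int N" by simp
  then show ?thesis
    using assms unfolding bdiff_def deformations_def displacements_def periodic_lattice_def
    by (elim disjE) (simp_all only: mem_Collect_eq, simp_all)
qed

lemma bdiff_line:
  "bdiff N (\<lambda>l. y l + s * v l + t * w l) l = bdiff N y l + s * bdiff N v l + t * bdiff N w l"
  by (simp add: bdiff_def diff_divide_distrib add_divide_distrib algebra_simps)

lemma bdiff_pos:
  assumes "N > 0" "y \<in> deformations N F" "\<And>l. l \<in> period_cell N \<Longrightarrow> bdiff N y l > 0"
  shows "bdiff N y l > 0"
proof -
  have per: "bdiff N y (m + 2 * int N * k) = bdiff N y m" for m k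
  proof (induction k rule: int_induct[of _ 0])
    case base then show ?case by simp
  next
    case (step1 i)
    have "m + 2 * int N * (i + 1) = (m + 2 * int N * i) + 2 * int N" by (simp add: algebra_simps)
    then show ?case using step1 bdiff_periodic[of y N F "m + 2 * int N * i"] assms(2) by metis
  next
    case (step2 i)
    have "m + 2 * int N * i = (m + 2 * int N * (i - 1)) + 2 * int N" by (simp add: algebra_simps)
    then show ?case using step2 bdiff_periodic[of y N F "m + 2 * int N * (i - 1)"] assms(2) by metis
  qed
  define k where "k = (l + int N - 1) div (2 * int N)"
  define m where "m = (l + int N - 1) mod (2 * int N) - int N + 1"
  have "l = m + 2 * int N * k" unfolding m_def k_def
    using div_mult_mod_eq[of "l + int N - 1" "2 * int N"] by (simp add: algebra_simps)
  moreover have "0 \<le> (l + int N - 1) mod (2 * int N)" "(l + int N - 1) mod (2 * int N) < 2 * int N"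
    using assms(1) by simp_all
  then have "m \<in> period_cell N" unfolding m_def period_cell_def by simp
  ultimately show ?thesis using per assms(3) by metis
qed

lemma sum_period_shift:
  assumes "N > 0" "g (int N + 1) = g (- int N + 1)"
  shows "(\<Sum>l\<in>period_cell N. g (l + 1)) = (\<Sum>l\<in>period_cell N. g (l::int) :: real)"
proof -
  have "(\<Sum>l\<in>period_cell N. g (l + 1)) = (\<Sum>l\<in>{- int N + 2 .. int N + 1}. g l)"
    by (rule sum.reindex_bij_witness[of _ "\<lambda>l. l - 1" "\<lambda>l. l + 1"]) (auto simp: period_cell_def)
  also have "{- int N + 2 .. int N + 1} = insert (int N + 1) {- int N + 2 .. int N}"
    using assms(1) by auto
  also have "sum g \<dots> = g (- int N + 1) + sum g {- int N + 2 .. int N}"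
    using assms(2) by simp
  also have "\<dots> = sum g (insert (- int N + 1) {- int N + 2 .. int N})"
    by simp
  also have "insert (- int N + 1) {- int N + 2 .. int N} = period_cell N"
    unfolding period_cell_def using assms(1) by auto
  finally show ?thesis .
qed

lemma second_variation_total_energy:
  assumes N: "N > 0" and \<phi>: "C_on 3 \<phi> {0<..}"
    and y: "y \<in> deformations N F" and v: "v \<in> displacements N"
    and pos: "\<And>l. l \<in> period_cell N \<Longrightarrow> bdiff N y l > 0"
  shows "second_variation (total_energy N F \<phi> f) y v v =
     eps N * (\<Sum>l\<in>period_cell N. (deriv ^^ 2) \<phi> (bdiff N y l) * \<bar>bdiff N v l\<bar>\<^sup>2) +
     eps N * (\<Sum>l\<in>period_cell N. (deriv ^^ 2) \<phi> (bdiff N y l + bdiff N y (l + 1)) *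
                \<bar>bdiff N v l + bdiff N v (l + 1)\<bar>\<^sup>2)"
proof -
  let ?C = "period_cell N"
  let ?Y = "bdiff N y" let ?V = "bdiff N v"
  let ?Y2 = "\<lambda>l. ?Y (l - 1) + ?Y l" let ?V2 = "\<lambda>l. ?V (l - 1) + ?V l"
  have fin: "finite ?C" by (simp add: period_cell_def)
  have Y: "?Y l > 0" for l using bdiff_pos[OF N y pos] by blast
  have Y2: "?Y2 l > 0" for l using Y[of l] Y[of "l - 1"] by simp
  have d1: "(\<phi> has_real_derivative deriv \<phi> x) (at x)" if "x > 0" for x
  proof -
    have "(deriv ^^ 0) \<phi> differentiable (at x)" using \<phi> that unfolding C_on_def
      by (metis greaterThan_iff zero_less_numeral)
    then show ?thesis by (simp add: DERIV_deriv_iff_real_differentiable)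
  qed
  have d2: "(deriv \<phi> has_real_derivative (deriv ^^ 2) \<phi> x) (at x)" if "x > 0" for x
  proof -
    have "(deriv ^^ 1) \<phi> differentiable (at x)" using \<phi> that unfolding C_on_def
      by (metis greaterThan_iff one_less_numeral_iff semiring_norm(77))
    then show ?thesis by (simp add: DERIV_deriv_iff_real_differentiable numeral_2_eq_2)
  qed
  have E: "total_energy N F \<phi> f (\<lambda>l. y l + s * v l + t * v l) =
     eps N * (\<Sum>l\<in>?C. \<phi> (?Y l + s * ?V l + t * ?V l)) +
     eps N * (\<Sum>l\<in>?C. \<phi> (?Y2 l + s * ?V2 l + t * ?V2 l)) -
     eps N * (\<Sum>l\<in>?C. f l * (y l + s * v l + t * v l - F * eps N * real_of_int l))" for s t
    unfolding total_energy_def stored_energy_def bdiff_line by (simp add: algebra_simps)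
  let ?D = "\<lambda>s. eps N * (\<Sum>l\<in>?C. deriv \<phi> (?Y l + s * ?V l) * ?V l) +
     eps N * (\<Sum>l\<in>?C. deriv \<phi> (?Y2 l + s * ?V2 l) * ?V2 l) - eps N * (\<Sum>l\<in>?C. f l * v l)"
  have inner: "deriv (\<lambda>t. total_energy N F \<phi> f (\<lambda>l. y l + s * v l + t * v l)) 0 = ?D s"
    if P: "\<forall>l\<in>?C. ?Y l + s * ?V l > 0 \<and> ?Y2 l + s * ?V2 l > 0" for s
  proof -
    have a: "((\<lambda>t. \<phi> (a + s * b + t * b)) has_real_derivative deriv \<phi> (a + s * b) * b) (at 0)"
      if "a + s * b > 0" for a b
      by (rule DERIV_chain2[where f = \<phi> and g = "\<lambda>t. a + s * b + t * b"])
         (use d1[OF that] in \<open>auto intro!: derivative_eq_intros\<close>)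
    show ?thesis unfolding E
      by (rule DERIV_imp_deriv, intro DERIV_diff DERIV_add DERIV_cmult DERIV_sum a)
         (use P in \<open>auto intro!: derivative_eq_intros\<close>)
  qed
  have ev1: "\<forall>\<^sub>F s in nhds (0::real). a + s * b > 0" if "a > 0" for a b :: real
  proof -
    have "((\<lambda>s. a + s * b) \<longlongrightarrow> a + 0 * b) (nhds 0)"
      by (intro tendsto_intros filterlim_ident)
    then show ?thesis using that order_tendstoD(1) by fastforce
  qed
  have "\<forall>\<^sub>F s in nhds 0. \<forall>l\<in>?C. ?Y l + s * ?V l > 0 \<and> ?Y2 l + s * ?V2 l > 0"
    using fin by (intro eventually_ball_finite ballI eventually_conj ev1 Y Y2)
  then have "\<forall>\<^sub>F s in nhds 0.
      deriv (\<lambda>t. total_energy N F \<phi> f (\<lambda>l. y l + s * v l + t * v l)) 0 = ?D s"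
    by (rule eventually_mono) (use inner in blast)
  then have "second_variation (total_energy N F \<phi> f) y v v = deriv ?D 0"
    unfolding second_variation_def by (rule deriv_cong_ev) simp
  also have "\<dots> = eps N * (\<Sum>l\<in>?C. (deriv ^^ 2) \<phi> (?Y l) * ?V l * ?V l) +
     eps N * (\<Sum>l\<in>?C. (deriv ^^ 2) \<phi> (?Y2 l) * ?V2 l * ?V2 l) - 0"
  proof -
    have b: "((\<lambda>s. deriv \<phi> (a + s * b) * b) has_real_derivative (deriv ^^ 2) \<phi> a * b * b) (at 0)"
      if "a > 0" for a b
      by (rule DERIV_cmult_right, rule DERIV_chain2[where f = "deriv \<phi>" and g = "\<lambda>s. a + s * b"])
         (use d2[OF that] in \<open>auto intro!: derivative_eq_intros\<close>)
    show ?thesis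
      by (rule DERIV_imp_deriv, intro DERIV_diff DERIV_add DERIV_cmult DERIV_sum DERIV_const b Y Y2)
  qed
  also have "(\<Sum>l\<in>?C. (deriv ^^ 2) \<phi> (?Y2 l) * ?V2 l * ?V2 l) =
      (\<Sum>l\<in>?C. (deriv ^^ 2) \<phi> (?Y l + ?Y (l + 1)) * (?V l + ?V (l + 1)) * (?V l + ?V (l + 1)))"
  proof -
    have p: "?Y (int N + 1) = ?Y (- int N + 1)" "?Y (int N) = ?Y (- int N)"
      "?V (int N + 1) = ?V (- int N + 1)" "?V (int N) = ?V (- int N)"
      using bdiff_periodic[of y N F "- int N + 1"] bdiff_periodic[of y N F "- int N"]
        bdiff_periodic[of v N F "- int N + 1"] bdiff_periodic[of v N F "- int N"] y v
      by (simp_all add: algebra_simps)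
    show ?thesis
      using sum_period_shift[of N "\<lambda>l. (deriv ^^ 2) \<phi> (?Y2 l) * ?V2 l * ?V2 l"] N p by simp
  qed
  finally show ?thesis by (simp add: power2_eq_square mult.assoc)
qed

end

theory Submission
  imports Defs
begin

text \<open>
  The strain bound places every next-nearest-neighbour distance \<open>y'\<^sub>l + y'\<^sub>l\<^sub>+\<^sub>1\<close> in
  \<open>[r\<^sub>*, \<infinity>)\<close>, where concavity gives \<open>\<phi>'' \<le> 0\<close>. Hence
  \<open>(a + b)\<^sup>2 \<le> 2 a\<^sup>2 + 2 b\<^sup>2\<close> bounds the second-neighbour terms of the second variation
  from below, and shifting the summation index over one period collects the coefficient
  \<open>A\<^sub>l\<close> in front of each \<open>\<bar>v'\<^sub>l\<bar>\<^sup>2\<close>.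
\<close>

text \<open>The graph of \<open>- f\<close> lies above its tangents. Adding the tangent inequality
  at \<open>x\<close>, evaluated at \<open>y\<close>, to the one with the roles exchanged cancels
  the function values and leaves a sign for \<open>(f' x - f' y) * (y - x)\<close>.\<close>

lemma concave_on_imp_deriv_antimono:
  fixes f f' :: "real \<Rightarrow> real"
  assumes conc: "concave_on S f" and S: "open S" "connected S"
    and f': "\<And>x. x \<in> S \<Longrightarrow> (f has_real_derivative f' x) (at x)"
    and xy: "x \<in> S" "y \<in> S" "x < y"
  shows "f' y \<le> f' x"
proof -
  have tangent: "- f' a * (b - a) \<le> - f b - - f a" if "a \<in> S" "b \<in> S" for a b
  proof (rule convex_on_imp_above_tangent[OF _ S(2) _ that(2)])
    show "convex_on S (\<lambda>x. - f x)"
      using conc by (simp add: concave_on_def)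
    show "a \<in> interior S"
      using S(1) that(1) by (simp add: interior_open)
    show "((\<lambda>x. - f x) has_real_derivative - f' a) (at a within S)"
      using DERIV_minus[OF f'[OF that(1)]] by (rule has_field_derivative_at_within)
  qed
  have "0 \<le> (f' x - f' y) * (y - x)"
    using tangent[OF xy(1,2)] tangent[OF xy(2,1)] by (simp add: algebra_simps)
  then show ?thesis
    using xy(3) by (simp add: zero_le_mult_iff)
qed

text \<open>If \<open>D\<close> were positive, \<open>f'\<close> would exceed \<open>f' x\<close> at
  all points slightly to the right of \<open>x\<close>, against the monotonicity just shown.\<close>

lemma concave_on_imp_deriv2_nonpos:
  fixes f f' :: "real \<Rightarrow> real"
  assumes conc: "concave_on S f" and S: "open S" "connected S"
    and f': "\<And>x. x \<in> S \<Longrightarrow> (f has_real_derivative f' x) (at x)"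
    and x: "x \<in> S" and D: "(f' has_real_derivative D) (at x)"
  shows "D \<le> 0"
proof (rule ccontr)
  assume "\<not> D \<le> 0"
  then obtain d where d: "d > 0" "\<And>h. 0 < h \<Longrightarrow> h < d \<Longrightarrow> f' x < f' (x + h)"
    using DERIV_pos_inc_right[OF D] by auto
  obtain e where e: "e > 0" "ball x e \<subseteq> S"
    using S(1) x by (auto simp: open_contains_ball)
  \<comment> \<open>Halving makes \<open>h\<close> strictly smaller than both radii:
    \<open>d\<close> for the increase of \<open>f'\<close>, \<open>e\<close> for staying inside
    \<open>S\<close>.\<close>
  define h where "h = min d e / 2"
  have h: "0 < h" "h < d" "h < e"
    using d(1) e(1) by (auto simp: h_def min_def)
  then have "x + h \<in> S"
    using e(2) by (auto simp: dist_real_def subset_eq)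
  then have "f' (x + h) \<le> f' x"
    using concave_on_imp_deriv_antimono[OF conc S f' x] h(1) by simp
  then show False
    using d(2)[OF h(1,2)] by simp
qed

lemma C_on_imp_has_real_derivative:
  assumes "C_on k f S" "j < k" "x \<in> S"
  shows "((deriv ^^ j) f has_real_derivative (deriv ^^ Suc j) f x) (at x)"
  using assms by (simp add: C_on_def DERIV_deriv_iff_real_differentiable)

text \<open>Beyond \<open>r\<close> the sign comes from concavity. The endpoint \<open>x = r\<close>
  has to be covered too, since two strains equal to \<open>r_star / 2\<close> add up to exactly
  \<open>r_star\<close>; there the sign survives as a limit from the right, \<open>\<phi>''\<close>
  being continuous.\<close>

lemma deriv2_nonpos_of_concave_on_Ioi:
  assumes \<phi>: "C_on k \<phi> {0<..}" "k > 2" and conc: "concave_on {r<..} \<phi>"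
    and r: "r > 0" "r \<le> x"
  shows "(deriv ^^ 2) \<phi> x \<le> 0"
proof -
  have neg: "(deriv ^^ 2) \<phi> z \<le> 0" if "z > r" for z
  proof (rule concave_on_imp_deriv2_nonpos[OF conc])
    show "(\<phi> has_real_derivative deriv \<phi> w) (at w)" if "w \<in> {r<..}" for w
      using C_on_imp_has_real_derivative[OF \<phi>(1), of 0 w] \<phi>(2) r(1) that by simp
    show "(deriv \<phi> has_real_derivative (deriv ^^ 2) \<phi> z) (at z)"
      using C_on_imp_has_real_derivative[OF \<phi>(1), of 1 z] \<phi>(2) r(1) that
      by (simp add: numeral_2_eq_2)
  qed (use that in auto)
  have "isCont ((deriv ^^ 2) \<phi>) x"
    using C_on_imp_has_real_derivative[OF \<phi>, of x] r by (auto intro: DERIV_isCont)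
  then have "((deriv ^^ 2) \<phi> \<longlongrightarrow> (deriv ^^ 2) \<phi> x) (at_right x)"
    by (auto simp: isCont_def intro: tendsto_mono[OF at_le])
  \<comment> \<open>The filter \<open>at_right x\<close> only sees \<open>z > x \<ge> r\<close>, so
    \<open>neg\<close> applies even when \<open>x = r\<close>.\<close>
  moreover have "\<forall>\<^sub>F z in at_right x. (deriv ^^ 2) \<phi> z \<le> 0"
    using neg r(2) by (auto simp: eventually_at_filter)
  ultimately show ?thesis
    by (intro tendsto_upperbound) auto
qed

text \<open>Periodicity of the strain carries a bound from one cell to all sites; it is needed
  because the neighbour \<open>l + 1\<close> of a site in the cell may lie outside it.\<close>

lemma bdiff_ge:
  assumes N: "N > 0" and y: "y \<in> deformations N F"
    and c: "\<And>l. l \<in> period_cell N \<Longrightarrow> c \<le> bdiff N y l"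
  shows "c \<le> bdiff N y l"
proof -
  \<comment> \<open>The offset \<open>N - 1\<close> sends the cell \<open>{- N + 1 .. N}\<close> to
    the remainders \<open>0 .. 2 * N - 1\<close>, so \<open>m\<close> is the representative of
    \<open>l\<close> in the cell.\<close>
  define k where "k = (l + int N - 1) div (2 * int N)"
  define m where "m = (l + int N - 1) mod (2 * int N) - int N + 1"
  have per: "bdiff N y (m + 2 * int N * i) = bdiff N y m" for i
  proof (induction i rule: int_induct[of _ 0])
    case base
    then show ?case by simp
  next
    case (step1 i)
    then show ?case
      using bdiff_periodic[of y N F "m + 2 * int N * i"] y by (simp add: algebra_simps)
  next
    case (step2 i)
    then show ?case
      using bdiff_periodic[of y N F "m + 2 * int N * (i - 1)"] y by (simp add: algebra_simps)
  qed
  have "l = m + 2 * int N * k"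
    unfolding m_def k_def
    using div_mult_mod_eq[of "l + int N - 1" "2 * int N"] by (simp add: algebra_simps)
  moreover have "m \<in> period_cell N"
    using N pos_mod_bound[of "2 * int N" "l + int N - 1"]
      pos_mod_sign[of "2 * int N" "l + int N - 1"]
    unfolding m_def period_cell_def atLeastAtMost_iff by linarith
  ultimately show ?thesis
    using per[of k] c by simp
qed

theorem proposition5:
  fixes N :: nat and F r_star :: real and \<phi> :: "real \<Rightarrow> real" and f y_qc :: "int \<Rightarrow> real"
  assumes "N > 0" and "F > 0" and "r_star > 0"
    and "C_on 3 \<phi> {0<..}"
    and "convex_on {0<..<r_star} \<phi>" and "concave_on {r_star<..} \<phi>"
    and "periodic_lattice N f"
    and "y_qc \<in> deformations N F"
    and "Min (bdiff N y_qc ` period_cell N) \<ge> r_star / 2"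
  shows "\<forall>v\<in>displacements N.
           second_variation (total_energy N F \<phi> f) y_qc v v
             \<ge> A_star N \<phi> y_qc * (l2_norm_eps N (bdiff N v))\<^sup>2"
proof
  fix v assume v: "v \<in> displacements N"
  let ?C = "period_cell N" and ?p = "(deriv ^^ 2) \<phi>"
  let ?Y = "bdiff N y_qc" and ?V = "bdiff N v"
  \<comment> \<open>\<open>g l\<close> belongs to the pair of bonds \<open>l\<close>,
    \<open>l + 1\<close>; the second-neighbour part of \<open>A_coeff\<close> at \<open>l\<close> is
    then \<open>2 * g (l - 1) + 2 * g l\<close>.\<close>
  define g where "g l = ?p (?Y l + ?Y (l + 1))" for l
  have fin: "finite ?C"
    by (simp add: period_cell_def)
  have eps: "eps N > 0"
    using \<open>N > 0\<close> by (simp add: eps_def)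
  have cell: "r_star / 2 \<le> ?Y l" if "l \<in> ?C" for l
    using assms(9) fin that by (meson Min_le finite_imageI imageI order_trans)
  have Y: "r_star / 2 \<le> ?Y l" for l
    using bdiff_ge[OF \<open>N > 0\<close> assms(8) cell] .
  have g: "g l \<le> 0" for l
    unfolding g_def using Y[of l] Y[of "l + 1"] \<open>r_star > 0\<close>
    by (intro deriv2_nonpos_of_concave_on_Ioi[OF assms(4) _ assms(6)]) auto
  have per: "?Y (l + 2 * int N) = ?Y l" "?V (l + 2 * int N) = ?V l" for l
    using bdiff_periodic assms(8) v by blast+
  have shift: "(\<Sum>l\<in>?C. g l * (?V (l + 1))\<^sup>2) = (\<Sum>l\<in>?C. g (l - 1) * (?V l)\<^sup>2)"
  proof -
    \<comment> \<open>These equalities make the summand \<open>g (l - 1) * (?V l)\<^sup>2\<close>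
      agree at \<open>N + 1\<close> and \<open>- N + 1\<close>, so the shifted sum wraps
      around.\<close>
    have "?Y (int N + 1) = ?Y (1 - int N)" "?Y (int N) = ?Y (- int N)"
      "?V (int N + 1) = ?V (1 - int N)"
      using per(1)[of "1 - int N"] per(1)[of "- int N"] per(2)[of "1 - int N"]
      by (simp_all add: algebra_simps)
    then show ?thesis
      using sum_period_shift[OF \<open>N > 0\<close>, of "\<lambda>l. g (l - 1) * (?V l)\<^sup>2"]
      by (simp add: g_def algebra_simps)
  qed
  have "A_star N \<phi> y_qc * (l2_norm_eps N ?V)\<^sup>2 =
      eps N * (\<Sum>l\<in>?C. A_star N \<phi> y_qc * (?V l)\<^sup>2)"
    using eps by (simp add: l2_norm_eps_def sum_nonneg sum_distrib_left algebra_simps)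
  also have "\<dots> \<le> eps N * (\<Sum>l\<in>?C. A_coeff N \<phi> y_qc l * (?V l)\<^sup>2)"
    using eps fin by (intro mult_left_mono sum_mono mult_right_mono) (auto simp: A_star_def)
  also have "(\<Sum>l\<in>?C. A_coeff N \<phi> y_qc l * (?V l)\<^sup>2) =
      (\<Sum>l\<in>?C. ?p (?Y l) * (?V l)\<^sup>2) +
      (\<Sum>l\<in>?C. 2 * g l * (?V l)\<^sup>2) + 2 * (\<Sum>l\<in>?C. g (l - 1) * (?V l)\<^sup>2)"
    by (simp add: A_coeff_def g_def sum.distrib sum_distrib_left algebra_simps)
  also have "\<dots> = (\<Sum>l\<in>?C. ?p (?Y l) * (?V l)\<^sup>2) +
      (\<Sum>l\<in>?C. g l * (2 * (?V l)\<^sup>2 + 2 * (?V (l + 1))\<^sup>2))"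
    unfolding shift[symmetric] by (simp add: sum.distrib sum_distrib_left algebra_simps)
  also have "eps N * \<dots> \<le> eps N * ((\<Sum>l\<in>?C. ?p (?Y l) * (?V l)\<^sup>2) +
      (\<Sum>l\<in>?C. g l * (?V l + ?V (l + 1))\<^sup>2))"
  proof -
    have "(?V l + ?V (l + 1))\<^sup>2 \<le> 2 * (?V l)\<^sup>2 + 2 * (?V (l + 1))\<^sup>2" for l
      using sum_squares_bound[of "?V l" "?V (l + 1)"] by (simp add: power2_sum)
    \<comment> \<open>Multiplication by \<open>g l \<le> 0\<close> turns the upper bound on the
      square into a lower bound on the energy term.\<close>
    then have "g l * (2 * (?V l)\<^sup>2 + 2 * (?V (l + 1))\<^sup>2) \<le> g l * (?V l + ?V (l + 1))\<^sup>2" for l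
      using g by (rule mult_left_mono_neg)
    then show ?thesis
      using eps by (simp add: sum_mono)
  qed
  also have "\<dots> = second_variation (total_energy N F \<phi> f) y_qc v v"
  proof -
    have "?Y l > 0" for l
      using Y[of l] \<open>r_star > 0\<close> by simp
    then show ?thesis
      using second_variation_total_energy[OF \<open>N > 0\<close> assms(4,8) v]
      by (simp add: g_def distrib_left)
  qed
  finally show "A_star N \<phi> y_qc * (l2_norm_eps N ?V)\<^sup>2
      \<le> second_variation (total_energy N F \<phi> f) y_qc v v" .
qed

end
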